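(* Let $\delta$ be a valley-free range map and $\mathcal{S}$ be a graded subset of $\mathsf{Cl}_\delta$ closed by prefix and by suffix reduction. If at least one of the following conditions is satisfied: (i) for any $n \geq 0$, the poset $\mathcal{S}(n)$ is a sublattice of $\mathsf{Cl}_\delta(n)$; (ii) for any $n \geq 0$, the poset $\mathcal{S}(n)$ is a meet semi-sublattice of $\mathsf{Cl}_\delta(n)$, and $\mathcal{S}$ is maximally extendable and join-stable; then $\mathbf{Cl}_{\mathcal{S}}$ has the interval condition.
   Context: A range map is a map $\delta : \mathbb{N}\setminus\{0\} \to \mathbb{N}$ (with $0 \in \mathbb{N}$). It is valley-free if there are no $1 \leq i_1 < i_2 < i_3$ such that $\delta(i_1) > \delta(i_2) < \delta(i_3)$. A $\delta$-cliff of size $n$ is a word $u = u_1 \cdots u_n$ of integers with $0 \leq u_i \leq \delta(i)$ for all $1 \leq i \leq n$; $\mathsf{Cl}_\delta(n)$ is the set of $\delta$-cliffs of size $n$ and $\mathsf{Cl}_\delta = \bigsqcup_{n\geq 0} \mathsf{Cl}_\delta(n)$; $|u|$ is the size of $u$. It is ordered by $u \preccurlyeq v$ iff $u$ and $v$ have the same size and $u_i \leq v_i$ for all $i$. Each $\mathsf{Cl}_\delta(n)$ is a lattice, with meet and join the componentwise minimum and maximum. Let $\mathbb{K}$ be a field of characteristic zero. $\mathbf{Cl}_\delta$ is the $\mathbb{K}$-vector space with basis $\{\mathsf{F}_u : u \in \mathsf{Cl}_\delta\}$. For $n \geq 0$, $\mathrm{r}_\delta : \mathbb{N}^n \to \mathsf{Cl}_\delta(n)$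 is defined by $\mathrm{r}_\delta(u)_i := \min\{u_i, \delta(i)\}$. The bilinear product of $\mathbf{Cl}_\delta$ is $$\mathsf{F}_u \cdot \mathsf{F}_v = \sum_{\substack{v' \in \mathrm{r}_\delta^{-1}(v)\\ uv' \in \mathsf{Cl}_\delta}} \mathsf{F}_{uv'},$$ where $uv'$ is the concatenation; it is unital, and associative when $\delta$ is valley-free. A graded subset $\mathcal{S}$ of $\mathsf{Cl}_\delta$ is a family $\mathcal{S} = \bigsqcup_{n\geq 0}\mathcal{S}(n)$ with $\mathcal{S}(n) \subseteq \mathsf{Cl}_\delta(n)$; each $\mathcal{S}(n)$ is a poset for $\preccurlyeq$. $\mathcal{S}$ is closed by prefix if all prefixes of elements of $\mathcal{S}$ belong to $\mathcal{S}$; closed by suffix reduction if for any $u \in \mathcal{S}$ and any suffix $u'$ of $u$, $\mathrm{r}_\delta(u') \in \mathcal{S}$; maximally extendable if the empty word belongs to $\mathcal{S}$ and $u \in \mathcal{S}$ implies $u\,\delta(|u|+1) \in \mathcal{S}$. A sublattice (resp. meet semi-sublattice) is a subset closed under meet and join (resp. under meet) of $\mathsf{Cl}_\delta(n)$. When every $\mathcal{S}(n)$ is a lattice (which holds under (ii), as a finite meet-semilattice with a greatest element is a lattice), with join operation $\vee'$, $\mathcal{S}$ is join-stable if for any $n \geq 0$, $u, v \in \mathcal{S}(n)$ and $i \in \{1,\dots,n\}$, $u_i = v_i$ implies that the $i$-th letter of $u \vee' v$ equals $u_i$. When $\mathcal{S}$ is closed by prefix and by suffix reduction, the linear span $\mathcal{V}_{\mathcal{S}}$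 of $\{\mathsf{F}_u : u \in \mathsf{Cl}_\delta \setminus \mathcal{S}\}$ is an ideal, and $\mathbf{Cl}_{\mathcal{S}} := \mathbf{Cl}_\delta / \mathcal{V}_{\mathcal{S}}$ is the quotient algebra, with basis $\{\mathsf{F}_u : u \in \mathcal{S}\}$. $\mathbf{Cl}_{\mathcal{S}}$ has the interval condition if for all $u, v \in \mathcal{S}$, the support of $\mathsf{F}_u \cdot \mathsf{F}_v$ in $\mathbf{Cl}_{\mathcal{S}}$ (the set of $w \in \mathcal{S}$ such that $\mathsf{F}_w$ has nonzero coefficient) is empty or is an interval of a poset $\mathcal{S}(n)$, $n \geq 0$. *)

theory Defs
  imports
    Complex_Main
    "HOL-Algebra.QuotRing"
    "HOL-Algebra.Module"
    "HOL-Algebra.Lattice"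
    "HOL-Library.Poly_Mapping"
    "HOL-Library.Sublist"
begin

text \<open>
  A range map is a function \<open>\<delta> :: nat \<Rightarrow> nat\<close> whose value at 0 is never used. Words are lists of
  naturals; lists are indexed from 0, so the letter \<open>u ! i\<close> is the \<open>(i + 1)\<close>-st one and is bounded
  by \<open>\<delta> (Suc i)\<close>.
\<close>

definition valley_free :: "(nat \<Rightarrow> nat) \<Rightarrow> bool" where
  "valley_free \<delta> \<longleftrightarrow>
     \<not> (\<exists>i1 i2 i3. 1 \<le> i1 \<and> i1 < i2 \<and> i2 < i3 \<and> \<delta> i1 > \<delta> i2 \<and> \<delta> i2 < \<delta> i3)"

definition cliffs :: "(nat \<Rightarrow> nat) \<Rightarrow> nat list set" where
  "cliffs \<delta> = {u. \<forall>i < length u. u ! i \<le> \<delta> (Suc i)}"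

definition level :: "nat list set \<Rightarrow> nat \<Rightarrow> nat list set" where
  "level S n = {u \<in> S. length u = n}"

text \<open>The order on words of the same size: \<open>list_all2\<close> includes equality of lengths.\<close>

definition level_poset :: "nat list set \<Rightarrow> nat \<Rightarrow> nat list gorder" where
  "level_poset S n = \<lparr>carrier = level S n, eq = (=), le = list_all2 (\<le>)\<rparr>"

definition reduce :: "(nat \<Rightarrow> nat) \<Rightarrow> nat list \<Rightarrow> nat list" where
  "reduce \<delta> u = map (\<lambda>i. min (u ! i) (\<delta> (Suc i))) [0..<length u]"


subsection \<open>Graded subsets\<close>

definition graded_subset :: "(nat \<Rightarrow> nat) \<Rightarrow> nat list set \<Rightarrow> bool" where
  "graded_subset \<delta> S \<longleftrightarrow> S \<subseteq> cliffs \<delta>"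

definition closed_by_prefix :: "nat list set \<Rightarrow> bool" where
  "closed_by_prefix S \<longleftrightarrow> (\<forall>u \<in> S. \<forall>p. prefix p u \<longrightarrow> p \<in> S)"

definition closed_by_suffix_reduction :: "(nat \<Rightarrow> nat) \<Rightarrow> nat list set \<Rightarrow> bool" where
  "closed_by_suffix_reduction \<delta> S \<longleftrightarrow> (\<forall>u \<in> S. \<forall>s. suffix s u \<longrightarrow> reduce \<delta> s \<in> S)"

definition maximally_extendable :: "(nat \<Rightarrow> nat) \<Rightarrow> nat list set \<Rightarrow> bool" where
  "maximally_extendable \<delta> S \<longleftrightarrow> [] \<in> S \<and> (\<forall>u \<in> S. u @ [\<delta> (Suc (length u))] \<in> S)"

text \<open>The meet and join in the next two definitions are those of the lattice of all cliffs of
  size \<open>n\<close>; they are shown below to be the componentwise minimum and maximum.\<close>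

definition meet_semi_sublattice :: "(nat \<Rightarrow> nat) \<Rightarrow> nat list set \<Rightarrow> nat \<Rightarrow> bool" where
  "meet_semi_sublattice \<delta> S n \<longleftrightarrow>
     (\<forall>u \<in> level S n. \<forall>v \<in> level S n. u \<sqinter>\<^bsub>level_poset (cliffs \<delta>) n\<^esub> v \<in> level S n)"

definition sublattice :: "(nat \<Rightarrow> nat) \<Rightarrow> nat list set \<Rightarrow> nat \<Rightarrow> bool" where
  "sublattice \<delta> S n \<longleftrightarrow>
     (\<forall>u \<in> level S n. \<forall>v \<in> level S n.
        u \<sqinter>\<^bsub>level_poset (cliffs \<delta>) n\<^esub> v \<in> level S n \<and>
        u \<squnion>\<^bsub>level_poset (cliffs \<delta>) n\<^esub> v \<in> level S n)"

text \<open>Here, by contrast, the join is that of the poset \<open>S(n)\<close> itself. The notion is only meaningful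
  when every \<open>S(n)\<close> is a lattice.\<close>

definition join_stable :: "nat list set \<Rightarrow> bool" where
  "join_stable S \<longleftrightarrow>
     (\<forall>n. \<forall>u \<in> level S n. \<forall>v \<in> level S n. \<forall>i < n.
        u ! i = v ! i \<longrightarrow> (u \<squnion>\<^bsub>level_poset S n\<^esub> v) ! i = u ! i)"


lemma level_poset_simps [simp]:
  "carrier (level_poset S n) = level S n"
  "u \<sqsubseteq>\<^bsub>level_poset S n\<^esub> v \<longleftrightarrow> list_all2 (\<le>) u v"
  by (simp_all add: level_poset_def)

lemma list_all2_le_antisym: "list_all2 (\<le>) u v \<Longrightarrow> list_all2 (\<le>) v u \<Longrightarrow> u = (v :: nat list)"
  by (rule list_all2_antisym) auto

lemma meet_cliffs:
  assumes "u \<in> level (cliffs \<delta>) n" "v \<in> level (cliffs \<delta>) n"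
  shows "u \<sqinter>\<^bsub>level_poset (cliffs \<delta>) n\<^esub> v = map2 min u v"
proof -
  let ?L = "level_poset (cliffs \<delta>) n"
  have "is_glb ?L (map2 min u v) {u, v}"
    using assms
    by (auto simp: greatest_def Lower_def level_def cliffs_def list_all2_conv_all_nth min_le_iff_disj)
  moreover have "x = y" if "is_glb ?L x {u, v}" "is_glb ?L y {u, v}" for x y
    using that by (auto simp: greatest_def intro: list_all2_le_antisym)
  ultimately show ?thesis
    unfolding meet_def inf_def by (metis (no_types, lifting) someI)
qed

lemma join_cliffs:
  assumes "u \<in> level (cliffs \<delta>) n" "v \<in> level (cliffs \<delta>) n"
  shows "u \<squnion>\<^bsub>level_poset (cliffs \<delta>) n\<^esub> v = map2 max u v"
proof -
  let ?L = "level_poset (cliffs \<delta>) n"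
  have "is_lub ?L (map2 max u v) {u, v}"
  proof (rule least_UpperI)
    show "map2 max u v \<in> carrier ?L"
      using assms by (simp add: level_def cliffs_def)
    show "x \<sqsubseteq>\<^bsub>?L\<^esub> map2 max u v" if "x \<in> {u, v}" for x
      using that assms by (auto simp: level_def list_all2_conv_all_nth)
    show "map2 max u v \<sqsubseteq>\<^bsub>?L\<^esub> y" if "y \<in> Upper ?L {u, v}" for y
    proof -
      have "list_all2 (\<le>) u y" "list_all2 (\<le>) v y"
        using that assms by (simp_all add: Upper_def)
      then show ?thesis by (simp add: list_all2_conv_all_nth)
    qed
  qed (use assms in auto)
  moreover have "x = y" if "is_lub ?L x {u, v}" "is_lub ?L y {u, v}" for x y
    using that by (auto simp: least_def intro: list_all2_le_antisym)
  ultimately show ?thesis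
    unfolding join_def sup_def by (metis (no_types, lifting) someI)
qed


subsection \<open>The algebra of cliffs and its quotients\<close>

text \<open>Formal linear combinations of words are finitely supported functions; the basis element
  indexed by \<open>u\<close> is \<open>F u\<close>.\<close>

abbreviation F :: "nat list \<Rightarrow> (nat list \<Rightarrow>\<^sub>0 'k::field)" where
  "F u \<equiv> Poly_Mapping.single u 1"

definition scale :: "'k::field \<Rightarrow> (nat list \<Rightarrow>\<^sub>0 'k) \<Rightarrow> (nat list \<Rightarrow>\<^sub>0 'k)" where
  "scale a p = Poly_Mapping.map ((*) a) p"

definition basis_prod :: "(nat \<Rightarrow> nat) \<Rightarrow> nat list \<Rightarrow> nat list \<Rightarrow> (nat list \<Rightarrow>\<^sub>0 'k::field)" where
  "basis_prod \<delta> u v = (\<Sum>v' | reduce \<delta> v' = v \<and> u @ v' \<in> cliffs \<delta>. F (u @ v'))"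

definition cliff_prod ::
    "(nat \<Rightarrow> nat) \<Rightarrow> (nat list \<Rightarrow>\<^sub>0 'k::field) \<Rightarrow> (nat list \<Rightarrow>\<^sub>0 'k) \<Rightarrow> (nat list \<Rightarrow>\<^sub>0 'k)" where
  "cliff_prod \<delta> p q =
     (\<Sum>u \<in> Poly_Mapping.keys p. \<Sum>v \<in> Poly_Mapping.keys q. scale (Poly_Mapping.lookup p u * Poly_Mapping.lookup q v) (basis_prod \<delta> u v))"

definition cliff_algebra :: "(nat \<Rightarrow> nat) \<Rightarrow> ('k::field, nat list \<Rightarrow>\<^sub>0 'k) module" where
  "cliff_algebra \<delta> =
     \<lparr>carrier = {p. Poly_Mapping.keys p \<subseteq> cliffs \<delta>}, mult = cliff_prod \<delta>, one = F [],
      zero = 0, add = (+), smult = scale\<rparr>"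

definition cliff_ideal :: "(nat \<Rightarrow> nat) \<Rightarrow> nat list set \<Rightarrow> (nat list \<Rightarrow>\<^sub>0 'k::field) set" where
  "cliff_ideal \<delta> S = Modules.module.span scale (F ` (cliffs \<delta> - S))"

text \<open>The quotient ring of the library carries no scalar multiplication, so it is extended by the
  one induced on cosets.\<close>

definition cliff_quotient ::
    "(nat \<Rightarrow> nat) \<Rightarrow> nat list set \<Rightarrow> ('k::field, (nat list \<Rightarrow>\<^sub>0 'k) set) module" where
  "cliff_quotient \<delta> S =
     ring.extend (cliff_algebra \<delta> Quot cliff_ideal \<delta> S)
       (module.fields (\<lambda>a X. \<Union>p \<in> X.
          cliff_ideal \<delta> S +>\<^bsub>cliff_algebra \<delta>\<^esub> (a \<odot>\<^bsub>cliff_algebra \<delta>\<^esub> p)))"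

definition quotient_basis ::
    "(nat \<Rightarrow> nat) \<Rightarrow> nat list set \<Rightarrow> nat list \<Rightarrow> (nat list \<Rightarrow>\<^sub>0 'k::field) set" where
  "quotient_basis \<delta> S u = cliff_ideal \<delta> S +>\<^bsub>cliff_algebra \<delta>\<^esub> F u"

text \<open>For \<open>S \<subseteq> cliffs \<delta>\<close> the family is unique: see \<open>quotient_coeffs_ex1\<close>.\<close>

definition quotient_coeffs ::
    "(nat \<Rightarrow> nat) \<Rightarrow> nat list set \<Rightarrow> (nat list \<Rightarrow>\<^sub>0 'k::field) set \<Rightarrow> (nat list \<Rightarrow>\<^sub>0 'k)" where
  "quotient_coeffs \<delta> S X =
     (THE c. Poly_Mapping.keys c \<subseteq> S \<and>
        X = (\<Oplus>\<^bsub>cliff_quotient \<delta> S\<^esub>w \<in> Poly_Mapping.keys c.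
               Poly_Mapping.lookup c w \<odot>\<^bsub>cliff_quotient \<delta> S\<^esub> quotient_basis \<delta> S w))"

definition quotient_support ::
    "(nat \<Rightarrow> nat) \<Rightarrow> nat list set \<Rightarrow> (nat list \<Rightarrow>\<^sub>0 'k::field) set \<Rightarrow> nat list set" where
  "quotient_support \<delta> S X = {w \<in> S. Poly_Mapping.lookup (quotient_coeffs \<delta> S X) w \<noteq> 0}"

definition interval_of :: "nat list set \<Rightarrow> nat \<Rightarrow> nat list set \<Rightarrow> bool" where
  "interval_of S n I \<longleftrightarrow>
     (\<exists>x \<in> level S n. \<exists>y \<in> level S n.
        x \<sqsubseteq>\<^bsub>level_poset S n\<^esub> y \<and> I = \<lbrace>x..y\<rbrace>\<^bsub>level_poset S n\<^esub>)"

text \<open>The type argument fixes the ground field.\<close>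

definition interval_condition :: "'k::field itself \<Rightarrow> (nat \<Rightarrow> nat) \<Rightarrow> nat list set \<Rightarrow> bool" where
  "interval_condition _ \<delta> S \<longleftrightarrow>
     (\<forall>u \<in> S. \<forall>v \<in> S.
        let I = quotient_support \<delta> S
                  ((quotient_basis \<delta> S u :: (nat list \<Rightarrow>\<^sub>0 'k) set)
                     \<otimes>\<^bsub>cliff_quotient \<delta> S\<^esub> quotient_basis \<delta> S v)
        in I = {} \<or> (\<exists>n. interval_of S n I))"


subsection \<open>Well-definedness of the coefficients\<close>

lemma lookup_scale [simp]: "Poly_Mapping.lookup (scale a p) w = a * Poly_Mapping.lookup p w"
  by (simp add: scale_def Poly_Mapping.map.rep_eq when_def)

lemma keys_scale: "Poly_Mapping.keys (scale a p) \<subseteq> Poly_Mapping.keys p"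
  by (auto simp: in_keys_iff)

lemma module_scale: "Modules.module (scale :: 'k::field \<Rightarrow> _)"
  by unfold_locales (auto intro!: poly_mapping_eqI simp: lookup_add algebra_simps)

lemma sum_scale_F:
  "(\<Sum>w \<in> Poly_Mapping.keys p. scale (Poly_Mapping.lookup p w) (F w)) = (p :: nat list \<Rightarrow>\<^sub>0 'k::field)"
proof (rule poly_mapping_eqI)
  fix w
  have "Poly_Mapping.lookup (\<Sum>v \<in> Poly_Mapping.keys p. scale (Poly_Mapping.lookup p v) (F v)) w
      = (\<Sum>v \<in> Poly_Mapping.keys p. if v = w then Poly_Mapping.lookup p v else 0)"
    unfolding lookup_sum by (intro sum.cong) (auto simp: lookup_single when_def)
  also have "\<dots> = Poly_Mapping.lookup p w"
    by (simp add: in_keys_iff)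
  finally show "Poly_Mapping.lookup (\<Sum>v \<in> Poly_Mapping.keys p. scale (Poly_Mapping.lookup p v) (F v)) w
      = Poly_Mapping.lookup p w" .
qed

lemma cliff_ideal_eq:
  "cliff_ideal \<delta> S = {p :: nat list \<Rightarrow>\<^sub>0 'k::field. Poly_Mapping.keys p \<subseteq> cliffs \<delta> - S}"
proof
  show "cliff_ideal \<delta> S \<subseteq> {p :: nat list \<Rightarrow>\<^sub>0 'k. Poly_Mapping.keys p \<subseteq> cliffs \<delta> - S}"
    unfolding cliff_ideal_def
  proof (rule Modules.module.span_minimal[OF module_scale])
    show "Modules.module.subspace scale {p :: nat list \<Rightarrow>\<^sub>0 'k. Poly_Mapping.keys p \<subseteq> cliffs \<delta> - S}"
      unfolding Modules.module.subspace_def[OF module_scale]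
      using Poly_Mapping.keys_add keys_scale by fastforce
  qed auto
  show "{p :: nat list \<Rightarrow>\<^sub>0 'k. Poly_Mapping.keys p \<subseteq> cliffs \<delta> - S} \<subseteq> cliff_ideal \<delta> S"
  proof
    fix p :: "nat list \<Rightarrow>\<^sub>0 'k" assume p: "p \<in> {p. Poly_Mapping.keys p \<subseteq> cliffs \<delta> - S}"
    have "(\<Sum>w \<in> Poly_Mapping.keys p. scale (Poly_Mapping.lookup p w) (F w)) \<in> cliff_ideal \<delta> S"
      unfolding cliff_ideal_def using p
      by (intro Modules.module.span_sum[OF module_scale] Modules.module.span_scale[OF module_scale]
            Modules.module.span_base[OF module_scale]) auto
    then show "p \<in> cliff_ideal \<delta> S" by (simp add: sum_scale_F)
  qed
qed

lemma cliff_algebra_simps [simp]: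
  "carrier (cliff_algebra \<delta>) = {p. Poly_Mapping.keys p \<subseteq> cliffs \<delta>}"
  "mult (cliff_algebra \<delta>) = cliff_prod \<delta>"
  "one (cliff_algebra \<delta>) = F []"
  "zero (cliff_algebra \<delta>) = 0"
  "add (cliff_algebra \<delta>) = (+)"
  "smult (cliff_algebra \<delta>) = scale"
  by (simp_all add: cliff_algebra_def)

lemma abelian_group_cliff_algebra:
  "abelian_group (cliff_algebra \<delta> :: ('k::field, nat list \<Rightarrow>\<^sub>0 'k) module)"
proof (rule abelian_groupI)
  fix p :: "nat list \<Rightarrow>\<^sub>0 'k" assume "p \<in> carrier (cliff_algebra \<delta>)"
  then show "\<exists>q \<in> carrier (cliff_algebra \<delta>). q \<oplus>\<^bsub>cliff_algebra \<delta>\<^esub> p = \<zero>\<^bsub>cliff_algebra \<delta>\<^esub>"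
    by (intro bexI[of _ "- p"]) (auto simp: in_keys_iff)
qed (use Poly_Mapping.keys_add in \<open>fastforce simp: algebra_simps\<close>)+

lemma coset_eq:
  "cliff_ideal \<delta> S +>\<^bsub>cliff_algebra \<delta>\<^esub> p
     = {q. Poly_Mapping.keys (q - p) \<subseteq> cliffs \<delta> - S}" (is "?A = ?B")
proof
  show "?A \<subseteq> ?B" by (auto simp: a_r_coset_def' cliff_ideal_eq)
  show "?B \<subseteq> ?A" by (force simp: a_r_coset_def' cliff_ideal_eq intro: bexI[of _ "_ - p"])
qed

lemma coset_eq_iff:
  fixes p q :: "nat list \<Rightarrow>\<^sub>0 'k::field"
  shows "cliff_ideal \<delta> S +>\<^bsub>cliff_algebra \<delta>\<^esub> p = cliff_ideal \<delta> S +>\<^bsub>cliff_algebra \<delta>\<^esub> q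
     \<longleftrightarrow> Poly_Mapping.keys (p - q) \<subseteq> cliffs \<delta> - S"
proof
  assume "cliff_ideal \<delta> S +>\<^bsub>cliff_algebra \<delta>\<^esub> p = cliff_ideal \<delta> S +>\<^bsub>cliff_algebra \<delta>\<^esub> q"
  moreover have "p \<in> cliff_ideal \<delta> S +>\<^bsub>cliff_algebra \<delta>\<^esub> p" by (simp add: coset_eq)
  ultimately show "Poly_Mapping.keys (p - q) \<subseteq> cliffs \<delta> - S" by (simp add: coset_eq)
next
  assume a: "Poly_Mapping.keys (p - q) \<subseteq> cliffs \<delta> - S"
  have eq: "Poly_Mapping.lookup p w = Poly_Mapping.lookup q w" if "w \<notin> cliffs \<delta> - S" for w
    using a that by (auto simp: in_keys_iff subset_iff lookup_minus)
  show "cliff_ideal \<delta> S +>\<^bsub>cliff_algebra \<delta>\<^esub> p = cliff_ideal \<delta> S +>\<^bsub>cliff_algebra \<delta>\<^esub> q"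
    unfolding coset_eq using eq by (auto simp: subset_iff in_keys_iff lookup_minus) metis+
qed

lemma coset_add:
  "(cliff_ideal \<delta> S +>\<^bsub>cliff_algebra \<delta>\<^esub> p) <+>\<^bsub>cliff_algebra \<delta>\<^esub> (cliff_ideal \<delta> S +>\<^bsub>cliff_algebra \<delta>\<^esub> q)
     = cliff_ideal \<delta> S +>\<^bsub>cliff_algebra \<delta>\<^esub> (p + q)" (is "?A = ?B")
proof
  show "?A \<subseteq> ?B"
    using Poly_Mapping.keys_add
    by (fastforce simp: set_add_def set_mult_def coset_eq add_diff_add)
  show "?B \<subseteq> ?A"
  proof
    fix x assume "x \<in> ?B"
    then have "x - q \<in> cliff_ideal \<delta> S +>\<^bsub>cliff_algebra \<delta>\<^esub> p" "x = (x - q) + q"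
      "q \<in> cliff_ideal \<delta> S +>\<^bsub>cliff_algebra \<delta>\<^esub> q"
      by (auto simp: coset_eq algebra_simps)
    then show "x \<in> ?A" by (force simp: set_add_def set_mult_def)
  qed
qed

lemma cliff_quotient_simps:
  "carrier (cliff_quotient \<delta> S :: ('k::field, (nat list \<Rightarrow>\<^sub>0 'k) set) module)
     = {cliff_ideal \<delta> S +>\<^bsub>cliff_algebra \<delta>\<^esub> p |p. Poly_Mapping.keys p \<subseteq> cliffs \<delta>}"
  "mult (cliff_quotient \<delta> S :: ('k::field, (nat list \<Rightarrow>\<^sub>0 'k) set) module) = rcoset_mult (cliff_algebra \<delta>) (cliff_ideal \<delta> S)"
  "zero (cliff_quotient \<delta> S :: ('k::field, (nat list \<Rightarrow>\<^sub>0 'k) set) module) = cliff_ideal \<delta> S +>\<^bsub>cliff_algebra \<delta>\<^esub> 0"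
  "add (cliff_quotient \<delta> S :: ('k::field, (nat list \<Rightarrow>\<^sub>0 'k) set) module) = set_add (cliff_algebra \<delta>)"
proof -
  have "cliff_ideal \<delta> S +>\<^bsub>cliff_algebra \<delta>\<^esub> 0 = (cliff_ideal \<delta> S :: (nat list \<Rightarrow>\<^sub>0 'k) set)"
    unfolding coset_eq by (simp add: cliff_ideal_eq)
  then show "zero (cliff_quotient \<delta> S :: ('k::field, (nat list \<Rightarrow>\<^sub>0 'k) set) module) = cliff_ideal \<delta> S +>\<^bsub>cliff_algebra \<delta>\<^esub> 0"
    by (simp add: cliff_quotient_def ring.defs module.defs FactRing_def)
qed (auto simp: cliff_quotient_def ring.defs module.defs FactRing_def A_RCOSETS_def' a_r_coset_def')

lemma cliff_quotient_smult:
  "a \<odot>\<^bsub>cliff_quotient \<delta> S\<^esub> (cliff_ideal \<delta> S +>\<^bsub>cliff_algebra \<delta>\<^esub> p)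
     = cliff_ideal \<delta> S +>\<^bsub>cliff_algebra \<delta>\<^esub> scale a p"
proof -
  have "cliff_ideal \<delta> S +>\<^bsub>cliff_algebra \<delta>\<^esub> scale a q = cliff_ideal \<delta> S +>\<^bsub>cliff_algebra \<delta>\<^esub> scale a p"
    if "q \<in> cliff_ideal \<delta> S +>\<^bsub>cliff_algebra \<delta>\<^esub> p" for q
    using that unfolding coset_eq_iff
    by (auto simp: coset_eq subset_iff in_keys_iff lookup_minus)
  moreover have "p \<in> cliff_ideal \<delta> S +>\<^bsub>cliff_algebra \<delta>\<^esub> p" by (simp add: coset_eq)
  ultimately have "(\<Union>q \<in> cliff_ideal \<delta> S +>\<^bsub>cliff_algebra \<delta>\<^esub> p.
      cliff_ideal \<delta> S +>\<^bsub>cliff_algebra \<delta>\<^esub> scale a q) = cliff_ideal \<delta> S +>\<^bsub>cliff_algebra \<delta>\<^esub> scale a p"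
    by blast
  then show ?thesis
    by (simp add: cliff_quotient_def ring.defs module.defs)
qed

lemma abelian_group_cliff_quotient:
  "abelian_group (cliff_quotient \<delta> S :: ('k::field, (nat list \<Rightarrow>\<^sub>0 'k) set) module)"
proof (rule abelian_groupI)
  fix X :: "(nat list \<Rightarrow>\<^sub>0 'k) set"
  assume "X \<in> carrier (cliff_quotient \<delta> S)"
  then obtain p where p: "Poly_Mapping.keys p \<subseteq> cliffs \<delta>"
    "X = cliff_ideal \<delta> S +>\<^bsub>cliff_algebra \<delta>\<^esub> p" by (auto simp: cliff_quotient_simps)
  then show "\<exists>Y \<in> carrier (cliff_quotient \<delta> S). Y \<oplus>\<^bsub>cliff_quotient \<delta> S\<^esub> X = \<zero>\<^bsub>cliff_quotient \<delta> S\<^esub>"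
    by (intro bexI[of _ "cliff_ideal \<delta> S +>\<^bsub>cliff_algebra \<delta>\<^esub> (- p)"])
      (auto simp: cliff_quotient_simps coset_add intro!: exI[of _ "- p"])
next
  fix X Y :: "(nat list \<Rightarrow>\<^sub>0 'k) set"
  assume "X \<in> carrier (cliff_quotient \<delta> S)" "Y \<in> carrier (cliff_quotient \<delta> S)"
  then obtain p q where pq: "Poly_Mapping.keys p \<subseteq> cliffs \<delta>" "Poly_Mapping.keys q \<subseteq> cliffs \<delta>"
    and XY: "X = cliff_ideal \<delta> S +>\<^bsub>cliff_algebra \<delta>\<^esub> p"
      "Y = cliff_ideal \<delta> S +>\<^bsub>cliff_algebra \<delta>\<^esub> q"
    unfolding cliff_quotient_simps by blast
  have "Poly_Mapping.keys (p + q) \<subseteq> cliffs \<delta>"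
    using Poly_Mapping.keys_add[of p q] pq by blast
  then show "X \<oplus>\<^bsub>cliff_quotient \<delta> S\<^esub> Y \<in> carrier (cliff_quotient \<delta> S)"
    unfolding cliff_quotient_simps XY coset_add by blast
next
  show "\<zero>\<^bsub>cliff_quotient \<delta> S\<^esub> \<in> carrier (cliff_quotient \<delta> S)"
    by (auto simp: cliff_quotient_simps intro!: exI[of _ 0])
qed (auto simp: cliff_quotient_simps coset_add add_ac)

lemma quotient_lincomb:
  assumes "S \<subseteq> cliffs \<delta>" "finite A" "A \<subseteq> S"
  shows "(\<Oplus>\<^bsub>cliff_quotient \<delta> S\<^esub>w \<in> A. c w \<odot>\<^bsub>cliff_quotient \<delta> S\<^esub> quotient_basis \<delta> S w)
    = cliff_ideal \<delta> S +>\<^bsub>cliff_algebra \<delta>\<^esub> (\<Sum>w \<in> A. scale (c w) (F w))"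
proof -
  interpret Q: abelian_group "cliff_quotient \<delta> S" by (rule abelian_group_cliff_quotient)
  have "c w \<odot>\<^bsub>cliff_quotient \<delta> S\<^esub> quotient_basis \<delta> S w \<in> carrier (cliff_quotient \<delta> S)"
    if "w \<in> S" for w
    using that assms(1) keys_scale[of "c w" "F w"]
    by (auto simp: quotient_basis_def cliff_quotient_smult cliff_quotient_simps
        intro!: exI[of _ "scale (c w) (F w)"])
  with assms(2,3) show ?thesis
    by (induction A rule: finite_induct)
      (simp_all add: cliff_quotient_simps(3,4) quotient_basis_def cliff_quotient_smult coset_add
        Q.finsum_insert Pi_iff subset_iff)
qed

lemma quotient_coeffs_ex1:
  fixes X :: "(nat list \<Rightarrow>\<^sub>0 'k::field) set"
  assumes S: "S \<subseteq> cliffs \<delta>" and X: "X \<in> carrier (cliff_quotient \<delta> S)"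
  shows "\<exists>!c. Poly_Mapping.keys c \<subseteq> S \<and>
           X = (\<Oplus>\<^bsub>cliff_quotient \<delta> S\<^esub>w \<in> Poly_Mapping.keys c.
                  Poly_Mapping.lookup c w \<odot>\<^bsub>cliff_quotient \<delta> S\<^esub> quotient_basis \<delta> S w)"
proof -
  from X obtain p where p: "Poly_Mapping.keys p \<subseteq> cliffs \<delta>"
    and Xp: "X = cliff_ideal \<delta> S +>\<^bsub>cliff_algebra \<delta>\<^esub> p" by (auto simp: cliff_quotient_simps)
  define c where "c = (\<Sum>w \<in> Poly_Mapping.keys p \<inter> S. scale (Poly_Mapping.lookup p w) (F w))"
  have c: "Poly_Mapping.lookup c w = (if w \<in> S then Poly_Mapping.lookup p w else 0)" for w
  proof -
    have "Poly_Mapping.lookup c w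
        = (\<Sum>v \<in> Poly_Mapping.keys p \<inter> S. if v = w then Poly_Mapping.lookup p v else 0)"
      unfolding c_def lookup_sum by (intro sum.cong) (auto simp: lookup_single when_def)
    then show ?thesis by (simp add: in_keys_iff)
  qed
  have lc: "(\<Oplus>\<^bsub>cliff_quotient \<delta> S\<^esub>w \<in> Poly_Mapping.keys d.
               Poly_Mapping.lookup d w \<odot>\<^bsub>cliff_quotient \<delta> S\<^esub> quotient_basis \<delta> S w)
      = cliff_ideal \<delta> S +>\<^bsub>cliff_algebra \<delta>\<^esub> d"
    if "Poly_Mapping.keys d \<subseteq> S" for d :: "nat list \<Rightarrow>\<^sub>0 'k"
    by (subst quotient_lincomb[OF S finite_keys that]) (simp only: sum_scale_F)
  show ?thesis
  proof (rule ex1I[of _ c])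
    have "Poly_Mapping.keys c \<subseteq> S" by (auto simp: in_keys_iff c split: if_splits)
    moreover have "Poly_Mapping.keys (p - c) \<subseteq> cliffs \<delta> - S"
      using p by (auto simp: in_keys_iff c lookup_minus subset_iff split: if_splits)
    ultimately show "Poly_Mapping.keys c \<subseteq> S \<and>
           X = (\<Oplus>\<^bsub>cliff_quotient \<delta> S\<^esub>w \<in> Poly_Mapping.keys c.
                  Poly_Mapping.lookup c w \<odot>\<^bsub>cliff_quotient \<delta> S\<^esub> quotient_basis \<delta> S w)"
      by (simp add: lc Xp coset_eq_iff)
  next
    fix d
    assume d: "Poly_Mapping.keys d \<subseteq> S \<and>
           X = (\<Oplus>\<^bsub>cliff_quotient \<delta> S\<^esub>w \<in> Poly_Mapping.keys d.
                  Poly_Mapping.lookup d w \<odot>\<^bsub>cliff_quotient \<delta> S\<^esub> quotient_basis \<delta> S w)"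
    then have "cliff_ideal \<delta> S +>\<^bsub>cliff_algebra \<delta>\<^esub> p = cliff_ideal \<delta> S +>\<^bsub>cliff_algebra \<delta>\<^esub> d"
      using lc[of d] Xp by metis
    then have "Poly_Mapping.keys (p - d) \<subseteq> cliffs \<delta> - S"
      by (simp only: coset_eq_iff)
    then have "Poly_Mapping.lookup d w = Poly_Mapping.lookup p w" if "w \<in> S" for w
    proof -
      have "w \<notin> Poly_Mapping.keys (p - d)"
        using that \<open>Poly_Mapping.keys (p - d) \<subseteq> cliffs \<delta> - S\<close> by blast
      then show ?thesis by (simp add: in_keys_iff lookup_minus)
    qed
    moreover have "Poly_Mapping.lookup d w = 0" if "w \<notin> S" for w
      using that d by (auto simp: in_keys_iff)
    ultimately show "d = c"
      by (intro poly_mapping_eqI) (simp add: c)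
  qed
qed

end

theory Submission
  imports Defs
begin

text \<open>
  For words \<open>u\<close> and \<open>v\<close> in \<open>S\<close>, the support of the product of their basis elements in the quotient
  consists of the words \<open>w \<in> S\<close> that begin with \<open>u\<close> and whose remaining suffix reduces to \<open>v\<close>
  (\<open>quotient_support_basis_prod\<close>). Passing from cosets to representatives is harmless, because the
  coefficient of \<open>w\<close> in a product only involves coefficients at prefixes of \<open>w\<close> and at reductions of
  suffixes of \<open>w\<close>, and all these words are in \<open>S\<close> when \<open>w\<close> is.

  Letterwise, membership of \<open>w\<close> in this set \<open>I\<close> says that each letter of \<open>w\<close> is either prescribed or
  only bounded from below: a letter of \<open>w\<close> reducing to the letter \<open>c\<close> of \<open>v\<close> at position \<open>i\<close> must
  equal \<open>c\<close> if \<open>c < \<delta> i\<close>, and must be at least \<open>c\<close> if \<open>c = \<delta> i\<close>. Three consequences follow. First,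
  \<open>I\<close> is convex in \<open>S(n)\<close>. Secondly, it contains the componentwise minimum of two of its
  elements as soon as \<open>S(n)\<close> does. Thirdly, it contains every upper bound in \<open>S(n)\<close> of two of its elements that keeps the letters on which these
  two agree; call such an upper bound stable. So if \<open>S(n)\<close> is closed under minimum and
  any two of its elements have a stable upper bound in it, then \<open>I\<close>, being finite, is empty
  or has a least and a greatest element, and by convexity it is the interval between them
  (\<open>interval_of_product_words\<close>).

  Under the first alternative, the componentwise maximum is a stable upper bound. Under the second,
  every \<open>S(n)\<close> has a greatest element, so two elements have a join in \<open>S(n)\<close>, namely the least of
  their common upper bounds; join-stability says precisely that this join is a stable upper bound.
\<close>

section \<open>The support of a product of basis elements\<close>

definition product_words :: "(nat \<Rightarrow> nat) \<Rightarrow> nat list set \<Rightarrow> nat list \<Rightarrow> nat list \<Rightarrow> nat list set" where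
  "product_words \<delta> S u v = {w \<in> S. prefix u w \<and> reduce \<delta> (drop (length u) w) = v}"

lemma length_reduce [simp]: "length (reduce \<delta> u) = length u"
  by (simp add: reduce_def)

lemma finite_cliffs_level: "finite (level (cliffs \<delta>) n)"
proof (rule finite_subset)
  show "level (cliffs \<delta>) n \<subseteq> {u. set u \<subseteq> (\<Union>i<n. {..\<delta> (Suc i)}) \<and> length u = n}"
    by (fastforce simp: level_def cliffs_def in_set_conv_nth)
  show "finite {u. set u \<subseteq> (\<Union>i<n. {..\<delta> (Suc i)}) \<and> length u = n}"
    by (intro finite_lists_length_eq) auto
qed

lemma finite_level: "S \<subseteq> cliffs \<delta> \<Longrightarrow> finite (level S n)"
  by (rule finite_subset[OF _ finite_cliffs_level[of \<delta> n]]) (auto simp: level_def)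

lemma lookup_basis_prod:
  "Poly_Mapping.lookup (basis_prod \<delta> u v :: nat list \<Rightarrow>\<^sub>0 'k::field) w
     = (if w \<in> product_words \<delta> (cliffs \<delta>) u v then 1 else 0)"
proof -
  let ?V = "{v'. reduce \<delta> v' = v \<and> u @ v' \<in> cliffs \<delta>}"
  have "finite ((\<lambda>v'. u @ v') ` ?V)"
    by (rule finite_subset[OF _ finite_cliffs_level[of \<delta> "length u + length v"]])
      (auto simp: level_def)
  then have fin: "finite ?V"
    by (rule finite_imageD) (auto simp: inj_on_def)
  have "Poly_Mapping.lookup (basis_prod \<delta> u v :: nat list \<Rightarrow>\<^sub>0 'k) w
      = (\<Sum>v' \<in> ?V. if w = u @ v' then 1 else 0)"
    unfolding basis_prod_def lookup_sum by (intro sum.cong) (auto simp: lookup_single when_def)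
  also have "\<dots> = (if w \<in> product_words \<delta> (cliffs \<delta>) u v then 1 else 0)"
  proof (cases "prefix u w")
    case True
    then obtain s where "w = u @ s" by (auto simp: prefix_def)
    then show ?thesis using fin by (simp add: product_words_def)
  next
    case False
    then show ?thesis by (auto simp: product_words_def intro!: sum.neutral)
  qed
  finally show ?thesis .
qed

text \<open>The product is dual to deconcatenation followed by reduction of the right factor. In this form
  the coefficient at \<open>w\<close> visibly depends on the two factors only through their coefficients at
  prefixes of \<open>w\<close> and at reduced suffixes of \<open>w\<close>.\<close>

lemma lookup_cliff_prod:
  fixes p q :: "nat list \<Rightarrow>\<^sub>0 'k::field"
  shows "Poly_Mapping.lookup (cliff_prod \<delta> p q) w
    = (if w \<in> cliffs \<delta>
       then \<Sum>u | prefix u w. Poly_Mapping.lookup p u * Poly_Mapping.lookup q (reduce \<delta> (drop (length u) w))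
       else 0)"
proof -
  let ?f = "\<lambda>u. Poly_Mapping.lookup p u * Poly_Mapping.lookup q (reduce \<delta> (drop (length u) w))"
  have fin: "finite {u. prefix u w}"
    by (rule finite_subset[of _ "set (prefixes w)"]) auto
  have inner: "(\<Sum>v \<in> Poly_Mapping.keys q.
        Poly_Mapping.lookup p u * Poly_Mapping.lookup q v * Poly_Mapping.lookup (basis_prod \<delta> u v) w)
      = (if w \<in> cliffs \<delta> \<and> prefix u w then ?f u else 0)" for u
  proof -
    have "(\<Sum>v \<in> Poly_Mapping.keys q.
        Poly_Mapping.lookup p u * Poly_Mapping.lookup q v * Poly_Mapping.lookup (basis_prod \<delta> u v) w)
      = (\<Sum>v \<in> Poly_Mapping.keys q. if v = reduce \<delta> (drop (length u) w)
           then (if w \<in> cliffs \<delta> \<and> prefix u w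
                 then Poly_Mapping.lookup p u * Poly_Mapping.lookup q v else 0) else 0)"
      by (intro sum.cong) (auto simp: lookup_basis_prod product_words_def)
    then show ?thesis by (simp add: in_keys_iff)
  qed
  have "Poly_Mapping.lookup (cliff_prod \<delta> p q) w
      = (\<Sum>u \<in> Poly_Mapping.keys p. if w \<in> cliffs \<delta> \<and> prefix u w then ?f u else 0)"
    unfolding cliff_prod_def lookup_sum lookup_scale inner ..
  also have "\<dots> = (if w \<in> cliffs \<delta> then \<Sum>u \<in> Poly_Mapping.keys p \<inter> {u. prefix u w}. ?f u else 0)"
    by (simp add: sum.inter_restrict)
  also have "(\<Sum>u \<in> Poly_Mapping.keys p \<inter> {u. prefix u w}. ?f u) = (\<Sum>u | prefix u w. ?f u)"
    by (rule sum.mono_neutral_left[OF fin]) (auto simp: in_keys_iff)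
  finally show ?thesis by simp
qed

lemma lookup_cliff_prod_basis:
  "Poly_Mapping.lookup (cliff_prod \<delta> (F u) (F v) :: nat list \<Rightarrow>\<^sub>0 'k::field) w
     = (if w \<in> product_words \<delta> (cliffs \<delta>) u v then 1 else 0)"
  by (simp add: cliff_prod_def lookup_basis_prod)

lemma lookup_eq_if_keys_diff_subset:
  fixes p q :: "'a \<Rightarrow>\<^sub>0 'b::ab_group_add"
  assumes "Poly_Mapping.keys (p - q) \<subseteq> A - S" "w \<in> S"
  shows "Poly_Mapping.lookup p w = Poly_Mapping.lookup q w"
  using assms by (force simp: in_keys_iff subset_iff lookup_minus)

text \<open>This is the ideal property in the form used below: the words of \<open>S\<close> only see
  words of \<open>S\<close>, so changing the factors modulo the ideal changes their product modulo the ideal.\<close>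

lemma cliff_prod_coset_cong:
  fixes p p' q q' :: "nat list \<Rightarrow>\<^sub>0 'k::field"
  assumes "closed_by_prefix S" "closed_by_suffix_reduction \<delta> S"
    and p: "Poly_Mapping.keys (p - p') \<subseteq> cliffs \<delta> - S"
    and q: "Poly_Mapping.keys (q - q') \<subseteq> cliffs \<delta> - S"
  shows "cliff_ideal \<delta> S +>\<^bsub>cliff_algebra \<delta>\<^esub> cliff_prod \<delta> p q
       = cliff_ideal \<delta> S +>\<^bsub>cliff_algebra \<delta>\<^esub> cliff_prod \<delta> p' q'"
proof -
  note agree = lookup_eq_if_keys_diff_subset
  have "Poly_Mapping.lookup (cliff_prod \<delta> p q) w = Poly_Mapping.lookup (cliff_prod \<delta> p' q') w"
    if w: "w \<in> S" for w
  proof -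
    have "u \<in> S" "reduce \<delta> (drop (length u) w) \<in> S" if "prefix u w" for u
      using assms(1,2) w that
      by (auto simp: closed_by_prefix_def closed_by_suffix_reduction_def suffix_drop)
    then show ?thesis
      unfolding lookup_cliff_prod by (auto simp: agree[OF p] agree[OF q] intro!: sum.cong)
  qed
  then show ?thesis
    unfolding coset_eq_iff by (auto simp: in_keys_iff lookup_minus lookup_cliff_prod split: if_splits)
qed

lemma quotient_basis_mult:
  assumes "closed_by_prefix S" "closed_by_suffix_reduction \<delta> S"
  shows "(quotient_basis \<delta> S u :: (nat list \<Rightarrow>\<^sub>0 'k::field) set)
           \<otimes>\<^bsub>cliff_quotient \<delta> S\<^esub> quotient_basis \<delta> S v
       = cliff_ideal \<delta> S +>\<^bsub>cliff_algebra \<delta>\<^esub> cliff_prod \<delta> (F u) (F v)"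
proof -
  have "cliff_ideal \<delta> S +>\<^bsub>cliff_algebra \<delta>\<^esub> cliff_prod \<delta> p q
      = cliff_ideal \<delta> S +>\<^bsub>cliff_algebra \<delta>\<^esub> cliff_prod \<delta> (F u) (F v)"
    if "p \<in> quotient_basis \<delta> S u" "q \<in> quotient_basis \<delta> S v" for p q :: "nat list \<Rightarrow>\<^sub>0 'k"
    using that by (intro cliff_prod_coset_cong[OF assms]) (auto simp: quotient_basis_def coset_eq)
  moreover have "F w \<in> (quotient_basis \<delta> S w :: (nat list \<Rightarrow>\<^sub>0 'k) set)" for w
    by (simp add: quotient_basis_def coset_eq)
  ultimately show ?thesis
    unfolding cliff_quotient_simps rcoset_mult_def cliff_algebra_simps by blast
qed

lemma quotient_support_coset:
  fixes p :: "nat list \<Rightarrow>\<^sub>0 'k::field"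
  assumes S: "S \<subseteq> cliffs \<delta>" and p: "Poly_Mapping.keys p \<subseteq> cliffs \<delta>"
  shows "quotient_support \<delta> S (cliff_ideal \<delta> S +>\<^bsub>cliff_algebra \<delta>\<^esub> p) = S \<inter> Poly_Mapping.keys p"
proof -
  let ?X = "cliff_ideal \<delta> S +>\<^bsub>cliff_algebra \<delta>\<^esub> p"
  let ?c = "quotient_coeffs \<delta> S ?X"
  have "?X \<in> carrier (cliff_quotient \<delta> S)"
    using p by (auto simp: cliff_quotient_simps)
  from theI'[OF quotient_coeffs_ex1[OF S this]]
  have keys: "Poly_Mapping.keys ?c \<subseteq> S"
    and "?X = (\<Oplus>\<^bsub>cliff_quotient \<delta> S\<^esub>w \<in> Poly_Mapping.keys ?c.
                 Poly_Mapping.lookup ?c w \<odot>\<^bsub>cliff_quotient \<delta> S\<^esub> quotient_basis \<delta> S w)"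
    unfolding quotient_coeffs_def by blast+
  then have "?X = cliff_ideal \<delta> S +>\<^bsub>cliff_algebra \<delta>\<^esub> ?c"
    by (simp only: quotient_lincomb[OF S finite_keys keys] sum_scale_F)
  then have "Poly_Mapping.keys (p - ?c) \<subseteq> cliffs \<delta> - S"
    by (simp only: coset_eq_iff)
  then have "Poly_Mapping.lookup p w = Poly_Mapping.lookup ?c w" if "w \<in> S" for w
    using that by (rule lookup_eq_if_keys_diff_subset)
  then show ?thesis
    by (auto simp: quotient_support_def in_keys_iff)
qed

lemma quotient_support_basis_prod:
  assumes S: "S \<subseteq> cliffs \<delta>" and "closed_by_prefix S" "closed_by_suffix_reduction \<delta> S"
  shows "quotient_support \<delta> S ((quotient_basis \<delta> S u :: (nat list \<Rightarrow>\<^sub>0 'k::field) set)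
           \<otimes>\<^bsub>cliff_quotient \<delta> S\<^esub> quotient_basis \<delta> S v) = product_words \<delta> S u v"
proof -
  have keys: "Poly_Mapping.keys (cliff_prod \<delta> (F u) (F v) :: nat list \<Rightarrow>\<^sub>0 'k)
      = product_words \<delta> (cliffs \<delta>) u v"
    by (auto simp: in_keys_iff lookup_cliff_prod_basis split: if_splits)
  then have "Poly_Mapping.keys (cliff_prod \<delta> (F u) (F v) :: nat list \<Rightarrow>\<^sub>0 'k) \<subseteq> cliffs \<delta>"
    by (auto simp: product_words_def)
  from quotient_support_coset[OF S this] show ?thesis
    unfolding quotient_basis_mult[OF assms(2,3)] keys using S by (auto simp: product_words_def)
qed

section \<open>Directed finite sets of words\<close>

lemma finite_directed_has_bound:
  assumes "finite A" "A \<noteq> {}" "transp R"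
    and directed: "\<And>x y. x \<in> A \<Longrightarrow> y \<in> A \<Longrightarrow> \<exists>z\<in>A. R z x \<and> R z y"
  shows "\<exists>m\<in>A. \<forall>x\<in>A. R m x"
proof -
  have "B \<subseteq> A \<longrightarrow> (\<exists>m\<in>A. \<forall>x\<in>B. R m x)" if "finite B" for B
    using that
  proof (induction B rule: finite_induct)
    case empty
    show ?case using assms(2) by auto
  next
    case (insert b B)
    show ?case
    proof
      assume b: "insert b B \<subseteq> A"
      then obtain m where m: "m \<in> A" "\<forall>x\<in>B. R m x" using insert.IH by auto
      with b directed[of m b] obtain z where "z \<in> A" "R z m" "R z b" by auto
      with m show "\<exists>m\<in>A. \<forall>x\<in>insert b B. R m x"
        using transpD[OF assms(3)] by blast
    qed
  qed
  with assms(1) show ?thesis by blast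
qed

lemma transp_list_all2_le: "transp (list_all2 (\<le>) :: nat list \<Rightarrow> nat list \<Rightarrow> bool)"
  by (rule transpI) (auto elim: list_all2_trans[rotated])

lemma list_all2_le_map2_min:
  assumes "length x = length (y :: nat list)"
  shows "list_all2 (\<le>) (map2 min x y) x" "list_all2 (\<le>) (map2 min x y) y"
  using assms by (auto simp: list_all2_conv_all_nth)

definition stable_upper_bounds :: "nat list set \<Rightarrow> bool" where
  "stable_upper_bounds A \<longleftrightarrow>
     (\<forall>x\<in>A. \<forall>y\<in>A. \<exists>z\<in>A. list_all2 (\<le>) x z \<and> list_all2 (\<le>) y z \<and>
        (\<forall>i<length x. x ! i = y ! i \<longrightarrow> z ! i = x ! i))"

section \<open>Supports are intervals\<close>

lemma product_words_iff:
  "w \<in> product_words \<delta> S u v \<longleftrightarrow>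
     w \<in> level S (length u + length v) \<and> (\<forall>i<length u. w ! i = u ! i) \<and>
     (\<forall>i<length v. min (w ! (length u + i)) (\<delta> (Suc i)) = v ! i)" (is "?L \<longleftrightarrow> ?R")
proof
  assume ?L
  then show ?R
    by (auto simp: product_words_def level_def prefix_def nth_append reduce_def)
next
  assume R: ?R
  then have "take (length u) w = u"
    by (intro nth_equalityI) (auto simp: level_def)
  then have "prefix u w" by (metis take_is_prefix)
  moreover have "reduce \<delta> (drop (length u) w) = v"
    using R by (intro nth_equalityI) (auto simp: level_def reduce_def)
  ultimately show ?L using R by (simp add: product_words_def level_def)
qed

lemma product_words_convex:
  assumes x: "x \<in> product_words \<delta> S u v" and y: "y \<in> product_words \<delta> S u v"
    and w: "w \<in> S" and le: "list_all2 (\<le>) x w" "list_all2 (\<le>) w y"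
  shows "w \<in> product_words \<delta> S u v"
proof -
  have len: "length w = length u + length v"
    using x list_all2_lengthD[OF le(1)] by (simp add: product_words_iff level_def)
  have between: "x ! i \<le> w ! i" "w ! i \<le> y ! i" if "i < length u + length v" for i
    using that le len by (auto simp: list_all2_conv_all_nth)
  have "w ! i = u ! i" if "i < length u" for i
    using between[of i] x y that by (simp add: product_words_iff)
  moreover have "min (w ! (length u + i)) (\<delta> (Suc i)) = v ! i" if i: "i < length v" for i
  proof (rule antisym)
    have "min (y ! (length u + i)) (\<delta> (Suc i)) = v ! i" "min (x ! (length u + i)) (\<delta> (Suc i)) = v ! i"
      using x y i by (simp_all add: product_words_iff)
    then show "min (w ! (length u + i)) (\<delta> (Suc i)) \<le> v ! i"
      "v ! i \<le> min (w ! (length u + i)) (\<delta> (Suc i))"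
      using between[of "length u + i"] i by linarith+
  qed
  ultimately show ?thesis using w len by (simp add: product_words_iff level_def)
qed

lemma product_words_min:
  assumes "x \<in> product_words \<delta> S u v" "y \<in> product_words \<delta> S u v" "map2 min x y \<in> S"
  shows "map2 min x y \<in> product_words \<delta> S u v"
proof -
  have "min (min a b) c = d" if "min a c = d" "min b c = d" for a b c d :: nat
    using that by linarith
  with assms show ?thesis by (auto simp: product_words_iff level_def)
qed

text \<open>A suffix letter whose reduction is below the bound \<open>\<delta> (Suc i)\<close> is unreduced, hence common to
  \<open>x\<close> and \<open>y\<close> and kept by stability; otherwise the bound is reached by \<open>x\<close>, and so by \<open>z\<close>.\<close>

lemma product_words_stable_upper_bound:
  assumes x: "x \<in> product_words \<delta> S u v" and y: "y \<in> product_words \<delta> S u v"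
    and z: "z \<in> S" and le: "list_all2 (\<le>) x z"
    and stable: "\<And>i. i < length x \<Longrightarrow> x ! i = y ! i \<Longrightarrow> z ! i = x ! i"
  shows "z \<in> product_words \<delta> S u v"
proof -
  have len: "length x = length u + length v" "length z = length u + length v"
    using x list_all2_lengthD[OF le] by (simp_all add: product_words_iff level_def)
  have "z ! i = u ! i" if "i < length u" for i
    using stable[of i] x y that len by (simp add: product_words_iff)
  moreover have "min (z ! (length u + i)) (\<delta> (Suc i)) = v ! i" if i: "i < length v" for i
  proof -
    have xv: "min (x ! (length u + i)) (\<delta> (Suc i)) = v ! i"
      and yv: "min (y ! (length u + i)) (\<delta> (Suc i)) = v ! i"
      using x y i by (simp_all add: product_words_iff)
    show ?thesis
    proof (cases "v ! i < \<delta> (Suc i)")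
      case True
      with xv yv have "x ! (length u + i) = y ! (length u + i)" by linarith
      with stable[of "length u + i"] i len xv show ?thesis by simp
    next
      case False
      moreover have "x ! (length u + i) \<le> z ! (length u + i)"
        using le i len by (simp add: list_all2_conv_all_nth)
      ultimately show ?thesis using xv by linarith
    qed
  qed
  ultimately show ?thesis using z len by (simp add: product_words_iff level_def)
qed

lemma interval_of_product_words:
  assumes S: "S \<subseteq> cliffs \<delta>"
    and meet: "\<And>n x y. x \<in> level S n \<Longrightarrow> y \<in> level S n \<Longrightarrow> map2 min x y \<in> S"
    and stable: "\<And>n. stable_upper_bounds (level S n)"
    and ne: "product_words \<delta> S u v \<noteq> {}"
  shows "interval_of S (length u + length v) (product_words \<delta> S u v)"
proof -
  let ?I = "product_words \<delta> S u v" and ?n = "length u + length v"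
  have sub: "?I \<subseteq> level S ?n" by (auto simp: product_words_iff)
  then have fin: "finite ?I" using finite_level[OF S] finite_subset by blast
  have len: "length x = ?n" if "x \<in> ?I" for x
    using that by (simp add: product_words_iff level_def)
  have "\<exists>m\<in>?I. \<forall>x\<in>?I. list_all2 (\<le>) m x"
  proof (rule finite_directed_has_bound[OF fin ne transp_list_all2_le])
    fix x y assume "x \<in> ?I" "y \<in> ?I"
    then have "map2 min x y \<in> ?I" "length x = length y"
      using meet sub by (auto intro!: product_words_min simp: len)
    then show "\<exists>z\<in>?I. list_all2 (\<le>) z x \<and> list_all2 (\<le>) z y"
      using list_all2_le_map2_min by blast
  qed
  then obtain m where m: "m \<in> ?I" "\<And>x. x \<in> ?I \<Longrightarrow> list_all2 (\<le>) m x" by blast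
  \<comment> \<open>The greatest element is a lower bound for the reversed order.\<close>
  have "\<exists>M\<in>?I. \<forall>x\<in>?I. (list_all2 (\<le>))\<inverse>\<inverse> M x"
  proof (rule finite_directed_has_bound[OF fin ne])
    show "transp (list_all2 (\<le>) :: nat list \<Rightarrow> nat list \<Rightarrow> bool)\<inverse>\<inverse>"
      using transp_list_all2_le by simp
    fix x y assume xy: "x \<in> ?I" "y \<in> ?I"
    then have "x \<in> level S ?n" "y \<in> level S ?n" using sub by auto
    then obtain z where z: "z \<in> level S ?n" "list_all2 (\<le>) x z" "list_all2 (\<le>) y z"
      "\<And>i. i < length x \<Longrightarrow> x ! i = y ! i \<Longrightarrow> z ! i = x ! i"
      using stable[of ?n] unfolding stable_upper_bounds_def by blast
    then have "z \<in> ?I"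
      using product_words_stable_upper_bound[OF xy] by (simp add: level_def)
    with z show "\<exists>z\<in>?I. (list_all2 (\<le>))\<inverse>\<inverse> z x \<and> (list_all2 (\<le>))\<inverse>\<inverse> z y" by auto
  qed
  then obtain M where M: "M \<in> ?I" "\<And>x. x \<in> ?I \<Longrightarrow> list_all2 (\<le>) x M" by auto
  have "?I = \<lbrace>m..M\<rbrace>\<^bsub>level_poset S ?n\<^esub>"
    using m M sub product_words_convex[OF m(1) M(1)]
    by (auto simp: at_least_at_most_def level_def)
  moreover have "m \<in> level S ?n" "M \<in> level S ?n" "list_all2 (\<le>) m M"
    using m(1) M sub by auto
  ultimately show ?thesis
    unfolding interval_of_def level_poset_simps by blast
qed

section \<open>Stable upper bounds under either alternative\<close>

lemma meet_semi_sublattice_map2_min: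
  assumes "S \<subseteq> cliffs \<delta>" "meet_semi_sublattice \<delta> S n" "x \<in> level S n" "y \<in> level S n"
  shows "map2 min x y \<in> level S n"
proof -
  have "x \<in> level (cliffs \<delta>) n" "y \<in> level (cliffs \<delta>) n"
    using assms by (auto simp: level_def)
  from meet_cliffs[OF this] show ?thesis
    using assms unfolding meet_semi_sublattice_def by metis
qed

lemma sublattice_stable_upper_bounds:
  assumes S: "S \<subseteq> cliffs \<delta>" and "sublattice \<delta> S n"
  shows "stable_upper_bounds (level S n)"
  unfolding stable_upper_bounds_def
proof (intro ballI)
  fix x y assume xy: "x \<in> level S n" "y \<in> level S n"
  then have "x \<in> level (cliffs \<delta>) n" "y \<in> level (cliffs \<delta>) n"
    using S by (auto simp: level_def)
  from join_cliffs[OF this] have "map2 max x y \<in> level S n"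
    using assms(2) xy unfolding sublattice_def by metis
  then show "\<exists>z\<in>level S n. list_all2 (\<le>) x z \<and> list_all2 (\<le>) y z \<and>
      (\<forall>i<length x. x ! i = y ! i \<longrightarrow> z ! i = x ! i)"
    using xy by (intro bexI[of _ "map2 max x y"]) (auto simp: level_def list_all2_conv_all_nth)
qed

lemma maximally_extendable_level_top:
  assumes S: "S \<subseteq> cliffs \<delta>" and "maximally_extendable \<delta> S"
  shows "\<exists>t \<in> level S n. \<forall>x \<in> level S n. list_all2 (\<le>) x t"
proof (intro bexI ballI)
  let ?t = "\<lambda>n. map (\<lambda>i. \<delta> (Suc i)) [0..<n]"
  have "?t n \<in> S" for n
  proof (induction n)
    case 0
    show ?case using assms(2) by (simp add: maximally_extendable_def)
  next
    case (Suc n)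
    then have "?t n @ [\<delta> (Suc (length (?t n)))] \<in> S"
      using assms(2) unfolding maximally_extendable_def by blast
    then show ?case by simp
  qed
  then show "?t n \<in> level S n" by (simp add: level_def)
  show "list_all2 (\<le>) x (?t n)" if "x \<in> level S n" for x
    using that S by (auto simp: level_def cliffs_def list_all2_conv_all_nth)
qed

text \<open>The join in the level poset is a choice among least upper bounds, so its defining property is
  available only once one is exhibited: the common upper bounds of \<open>x\<close> and \<open>y\<close> contain the top of
  the level and are closed under minimum, and so they have a least element.\<close>

lemma join_level_is_lub:
  assumes S: "S \<subseteq> cliffs \<delta>" and meet: "meet_semi_sublattice \<delta> S n"
    and max: "maximally_extendable \<delta> S"
    and xy: "x \<in> level S n" "y \<in> level S n"
  shows "is_lub (level_poset S n) (x \<squnion>\<^bsub>level_poset S n\<^esub> y) {x, y}"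
proof -
  let ?U = "{z \<in> level S n. list_all2 (\<le>) x z \<and> list_all2 (\<le>) y z}"
  have "finite ?U" using finite_level[OF S] by simp
  moreover have "?U \<noteq> {}"
    using maximally_extendable_level_top[OF S max, of n] xy by blast
  ultimately have "\<exists>m\<in>?U. \<forall>z\<in>?U. list_all2 (\<le>) m z"
  proof (rule finite_directed_has_bound[OF _ _ transp_list_all2_le])
    fix a b assume ab: "a \<in> ?U" "b \<in> ?U"
    then have "map2 min a b \<in> level S n"
      using meet_semi_sublattice_map2_min[OF S meet] by simp
    then have "map2 min a b \<in> ?U"
      using ab by (auto simp: list_all2_conv_all_nth)
    moreover have "length a = length b" using ab by (simp add: level_def)
    ultimately show "\<exists>z\<in>?U. list_all2 (\<le>) z a \<and> list_all2 (\<le>) z b"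
      using list_all2_le_map2_min by blast
  qed
  then obtain m where m: "m \<in> ?U" "\<And>z. z \<in> ?U \<Longrightarrow> list_all2 (\<le>) m z" by blast
  then have "is_lub (level_poset S n) m {x, y}"
    using xy by (auto simp: least_def Upper_def)
  then show ?thesis unfolding join_def sup_def by (rule someI)
qed

lemma join_stable_stable_upper_bounds:
  assumes "S \<subseteq> cliffs \<delta>" "meet_semi_sublattice \<delta> S n" "maximally_extendable \<delta> S"
    and stable: "join_stable S"
  shows "stable_upper_bounds (level S n)"
  unfolding stable_upper_bounds_def
proof (intro ballI)
  fix x y assume xy: "x \<in> level S n" "y \<in> level S n"
  let ?j = "x \<squnion>\<^bsub>level_poset S n\<^esub> y"
  have "?j \<in> level S n" "list_all2 (\<le>) x ?j" "list_all2 (\<le>) y ?j"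
    using join_level_is_lub[OF assms(1-3) xy] xy by (auto simp: least_def Upper_def)
  moreover have "\<forall>i<length x. x ! i = y ! i \<longrightarrow> ?j ! i = x ! i"
    using stable xy by (auto simp: join_stable_def level_def)
  ultimately show "\<exists>z\<in>level S n. list_all2 (\<le>) x z \<and> list_all2 (\<le>) y z \<and>
      (\<forall>i<length x. x ! i = y ! i \<longrightarrow> z ! i = x ! i)"
    by blast
qed

theorem theorem3p2p2:
  fixes \<delta> :: "nat \<Rightarrow> nat" and S :: "nat list set"
  assumes "valley_free \<delta>"
    and "graded_subset \<delta> S"
    and "closed_by_prefix S"
    and "closed_by_suffix_reduction \<delta> S"
    and "(\<forall>n. sublattice \<delta> S n) \<or>
         ((\<forall>n. meet_semi_sublattice \<delta> S n) \<and> maximally_extendable \<delta> S \<and> join_stable S)"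
  shows "interval_condition TYPE('k::field_char_0) \<delta> S"
proof -
  have S: "S \<subseteq> cliffs \<delta>" using assms(2) by (simp add: graded_subset_def)
  have "meet_semi_sublattice \<delta> S n" for n
    using assms(5) by (auto simp: sublattice_def meet_semi_sublattice_def)
  then have "map2 min x y \<in> S" if "x \<in> level S n" "y \<in> level S n" for n x y
    using meet_semi_sublattice_map2_min[OF S _ that] by (simp add: level_def)
  moreover have "stable_upper_bounds (level S n)" for n
    using assms(5) sublattice_stable_upper_bounds[OF S] join_stable_stable_upper_bounds[OF S] by blast
  ultimately have "product_words \<delta> S u v = {} \<or> (\<exists>n. interval_of S n (product_words \<delta> S u v))" for u v
    using interval_of_product_words[OF S] by blast
  then show ?thesis
    unfolding interval_condition_def quotient_support_basis_prod[OF S assms(3,4)] Let_def by blast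
qed

end
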